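(* Let $(X,T)$ be a topological dynamical system with a metric $d$ and let $f\in C(X,\mathbb{R})$. Then for every $\epsilon>0$, $$\overline{\mathrm{mdim}}_M(T,f,X,d)=\limsup_{\delta\to 0}\frac{1}{\log\frac1\delta}\,GR\Big(\sup_{x\in X}P_n(T,f,T^{-n}W_\epsilon^s(x,T),d,\delta)\Big).$$
   Context: A topological dynamical system (TDS) $(X,T)$ with metric $d$: $X$ is a compact metrizable space with compatible metric $d$, and $T:X\to X$ is continuous. $C(X,\mathbb{R})$ is the space of real continuous functions. Write $S_nf(x)=\sum_{j=0}^{n-1}f(T^jx)$ and $d_n(x,y)=\max_{0\le j\le n-1}d(T^jx,T^jy)$. The $\epsilon$-stable set of $x$ is $W_\epsilon^s(x,T)=\{y\in X:d(T^jx,T^jy)\le\epsilon\text{ for all }j=0,1,2,\dots\}$; $T^{-n}W_\epsilon^s(x,T)$ is its preimage under $T^n$. For $Z\subset X$, a set $E\subset X$ is an $(n,\epsilon)$-spanning set of $Z$ if every $x\in Z$ has some $y\in E$ with $d_n(x,y)<\epsilon$. Put $P_n(T,f,Z,d,\epsilon)=\inf\{\sum_{x\in E}(1/\epsilon)^{S_nf(x)}\}$ over all $(n,\epsilon)$-spanning sets $E$ of $Z$ (so $P_n=0$ when $Z=\emptyset$), $P(T,f,Z,d,\epsilon)=\limsup_{n\to\infty}\frac1n\log P_n(T,f,Z,d,\epsilon)$, and $\overline{\mathrm{mdim}}_M(T,f,Z,d)=\limsup_{\epsilon\to0}\frac{P(T,f,Z,d,\epsilon)}{\log\frac1\epsilon}$.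 The exponential growth rate of a positive sequence $\{p_n\}_{n\ge1}$ is $GR(p_n)=\limsup_{n\to\infty}\frac{\log p_n}{n}$. *)

theory Defs
  imports "HOL-Analysis.Analysis"
begin

text \<open>
  A compact metrizable space with a compatible metric is given as a carrier \<open>X\<close> with a metric
  \<open>d\<close> on it; its topology is the metric topology of \<open>d\<close>.  The map \<open>T\<close> and the potential \<open>f\<close>
  are total functions of which only the values on \<open>X\<close> matter.
\<close>

definition tds :: "'a set \<Rightarrow> ('a \<Rightarrow> 'a \<Rightarrow> real) \<Rightarrow> ('a \<Rightarrow> 'a) \<Rightarrow> bool" where
  "tds X d T \<longleftrightarrow> Metric_space X d \<and> compact_space (Metric_space.mtopology X d) \<and>
     continuous_map (Metric_space.mtopology X d) (Metric_space.mtopology X d) T"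

definition birkhoff_sum :: "('a \<Rightarrow> 'a) \<Rightarrow> ('a \<Rightarrow> real) \<Rightarrow> nat \<Rightarrow> 'a \<Rightarrow> real" where
  "birkhoff_sum T f n x = (\<Sum>j<n. f ((T ^^ j) x))"

text \<open>Only meaningful for \<open>n \<ge> 1\<close>, which suffices since all uses are under a limit in \<open>n\<close>.\<close>

definition bowen_dist :: "('a \<Rightarrow> 'a) \<Rightarrow> ('a \<Rightarrow> 'a \<Rightarrow> real) \<Rightarrow> nat \<Rightarrow> 'a \<Rightarrow> 'a \<Rightarrow> real" where
  "bowen_dist T d n x y = Max ((\<lambda>j. d ((T ^^ j) x) ((T ^^ j) y)) ` {..<n})"

definition stable_set ::
  "'a set \<Rightarrow> ('a \<Rightarrow> 'a \<Rightarrow> real) \<Rightarrow> ('a \<Rightarrow> 'a) \<Rightarrow> real \<Rightarrow> 'a \<Rightarrow> 'a set" where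
  "stable_set X d T \<epsilon> x = {y \<in> X. \<forall>j. d ((T ^^ j) x) ((T ^^ j) y) \<le> \<epsilon>}"

definition spanning ::
  "'a set \<Rightarrow> ('a \<Rightarrow> 'a) \<Rightarrow> 'a set \<Rightarrow> ('a \<Rightarrow> 'a \<Rightarrow> real) \<Rightarrow> nat \<Rightarrow> real \<Rightarrow> 'a set \<Rightarrow> bool" where
  "spanning X T Z d n \<epsilon> E \<longleftrightarrow> E \<subseteq> X \<and> (\<forall>x\<in>Z. \<exists>y\<in>E. bowen_dist T d n x y < \<epsilon>)"

text \<open>
  The infimum is over all spanning sets, finite or not; the sum of the (positive) weights is the
  unordered sum in \<open>[0, \<infinity>]\<close>.
\<close>

definition press_sum ::
  "'a set \<Rightarrow> ('a \<Rightarrow> 'a) \<Rightarrow> ('a \<Rightarrow> real) \<Rightarrow> 'a set \<Rightarrow> ('a \<Rightarrow> 'a \<Rightarrow> real) \<Rightarrow> real \<Rightarrow> nat \<Rightarrow> ennreal"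
where
  "press_sum X T f Z d \<epsilon> n =
     (INF E\<in>{E. spanning X T Z d n \<epsilon> E}.
        \<Sum>\<^sub>\<infinity>x\<in>E. ennreal ((1 / \<epsilon>) powr birkhoff_sum T f n x))"

definition ext_ln :: "ennreal \<Rightarrow> ereal" where
  "ext_ln p = (if p = 0 then - \<infinity> else if p = \<infinity> then \<infinity> else ereal (ln (enn2real p)))"

definition growth_rate :: "(nat \<Rightarrow> ennreal) \<Rightarrow> ereal" where
  "growth_rate p = limsup (\<lambda>n. ext_ln (p n) / ereal (real n))"

definition press ::
  "'a set \<Rightarrow> ('a \<Rightarrow> 'a) \<Rightarrow> ('a \<Rightarrow> real) \<Rightarrow> 'a set \<Rightarrow> ('a \<Rightarrow> 'a \<Rightarrow> real) \<Rightarrow> real \<Rightarrow> ereal" where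
  "press X T f Z d \<epsilon> = limsup (\<lambda>n. ext_ln (press_sum X T f Z d \<epsilon> n) / ereal (real n))"

definition upper_mdim ::
  "'a set \<Rightarrow> ('a \<Rightarrow> 'a) \<Rightarrow> ('a \<Rightarrow> real) \<Rightarrow> 'a set \<Rightarrow> ('a \<Rightarrow> 'a \<Rightarrow> real) \<Rightarrow> ereal" where
  "upper_mdim X T f Z d = Limsup (at_right 0) (\<lambda>\<epsilon>. press X T f Z d \<epsilon> / ereal (ln (1 / \<epsilon>)))"

end

theory Submission
  imports Defs "HOL-Real_Asymp.Real_Asymp"
begin

text \<open>
  Fix \<open>n\<close> and \<open>\<delta> \<le> \<epsilon> / 2\<close>, and let \<open>K\<close> exceed \<open>P\<^sub>n(T, f, T\<^sup>-\<^sup>n W(x), \<delta>)\<close> for all \<open>x\<close>, where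
  \<open>W(x)\<close> is the \<open>\<epsilon>\<close>-stable set.  By compactness, for some finite \<open>m\<close> all preimages under \<open>T\<^sup>n\<close> of
  closed Bowen balls of length \<open>m\<close> and radius \<open>\<epsilon>\<close> still have an \<open>(n, \<delta>)\<close>-spanning set of weight
  below \<open>K\<close>.  A set \<open>A\<close> of \<open>d\<^sub>m\<close>-diameter at most \<open>\<epsilon>\<close> lies in such a ball, and the pieces into which
  the spanning set cuts the preimage of \<open>A\<close> again have \<open>d\<^sub>m\<close>-diameter at most \<open>\<epsilon>\<close>, because
  \<open>2\<delta> \<le> \<epsilon>\<close>.  Hence the step can be iterated backwards in time: the preimage of \<open>A\<close> under \<open>T\<^sup>k\<^sup>n\<close>
  has a \<open>(kn, 2\<delta>)\<close>-spanning set of weight at most \<open>(K L\<^sup>n)\<^sup>k\<close>, where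
  \<open>ln L = \<eta> ln (1/\<delta>) + \<parallel>f\<parallel> ln 2\<close> and \<open>\<eta>\<close> bounds the oscillation of \<open>f\<close> at scale \<open>\<delta>\<close>.  As finitely
  many sets \<open>A\<close> cover \<open>X\<close>, the pressure of \<open>X\<close> at scale \<open>2\<delta>\<close> is at most \<open>(ln K) / n + ln L\<close>, and
  \<open>ln L / ln (1/\<delta>)\<close> becomes negligible as \<open>\<delta> \<rightarrow> 0\<close>.  The other inequality is monotonicity.
\<close>

section \<open>Bowen metrics, Birkhoff sums and extended logarithms\<close>

lemma bowen_dist_less_iff:
  assumes "n > 0"
  shows "bowen_dist T d n x y < \<delta> \<longleftrightarrow> (\<forall>j<n. d ((T ^^ j) x) ((T ^^ j) y) < \<delta>)"
  using assms unfolding bowen_dist_def by (subst Max_less_iff) auto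

lemma birkhoff_sum_add:
  "birkhoff_sum T f (m + n) x = birkhoff_sum T f m x + birkhoff_sum T f n ((T ^^ m) x)"
proof -
  have "(\<Sum>j<m + n. f ((T ^^ j) x)) = (\<Sum>j<m. f ((T ^^ j) x)) + (\<Sum>j<n. f ((T ^^ (m + j)) x))"
    by (induction n) auto
  moreover have "(T ^^ (m + j)) x = (T ^^ j) ((T ^^ m) x)" for j
    by (subst add.commute) (simp add: funpow_add)
  ultimately show ?thesis
    by (simp add: birkhoff_sum_def)
qed

lemma ext_ln_mono:
  assumes "p \<le> q"
  shows "ext_ln p \<le> ext_ln q"
proof (cases "p = 0 \<or> q = \<infinity>")
  case False
  then have "0 < p" "p < \<infinity>" "0 < q" "q < \<infinity>"
    using assms by (auto simp: top.not_eq_extremum intro: le_less_trans less_le_trans gr_zeroI)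
  then have "0 < enn2real p" "enn2real p \<le> enn2real q"
    using assms by (auto simp: enn2real_positive_iff intro!: enn2real_mono)
  then show ?thesis
    using False assms by (auto simp: ext_ln_def top_unique)
qed (auto simp: ext_ln_def)

lemma ext_ln_ennreal: "r > 0 \<Longrightarrow> ext_ln (ennreal r) = ereal (ln r)"
  by (simp add: ext_ln_def)

lemma less_ennreal_exp:
  assumes "ext_ln p < ereal t"
  shows "p < ennreal (exp t)"
  using ext_ln_mono[of "ennreal (exp t)" p] assms by (force simp: ext_ln_ennreal not_less[symmetric])

text \<open>The union is the image of the disjoint union \<open>Sigma I A\<close> under
  \<open>snd\<close>; as \<open>g\<close> is nonnegative, counting overlaps repeatedly can only
  increase the sum. This allows spanning sets of different pieces to intersect.\<close>

lemma sum_UNION_le: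
  fixes g :: "'b \<Rightarrow> real"
  assumes "finite I" "\<And>i. i \<in> I \<Longrightarrow> finite (A i)" "\<And>x. g x \<ge> 0"
  shows "sum g (\<Union>i\<in>I. A i) \<le> (\<Sum>i\<in>I. sum g (A i))"
proof -
  have "(\<Union>i\<in>I. A i) = snd ` Sigma I A"
    by force
  then have "sum g (\<Union>i\<in>I. A i) \<le> sum (g \<circ> snd) (Sigma I A)"
    using sum_image_le[of "Sigma I A" g snd] assms by auto
  also have "\<dots> = (\<Sum>i\<in>I. sum g (A i))"
    using assms by (subst sum.Sigma) (auto simp: case_prod_unfold)
  finally show ?thesis .
qed

lemma press_sum_mono:
  assumes "Z \<subseteq> Z'"
  shows "press_sum X T f Z d \<delta> n \<le> press_sum X T f Z' d \<delta> n"
  unfolding press_sum_def using assms by (intro INF_superset_mono) (auto 0 3 simp: spanning_def)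

section \<open>Limits along iterates of a compact system\<close>

locale compact_dynamics = Metric_space X d for X :: "'a set" and d +
  fixes T :: "'a \<Rightarrow> 'a"
  assumes compact_X: "compact_space mtopology"
    and cont: "continuous_map mtopology mtopology T"
begin

lemma continuous_map_iterate: "continuous_map mtopology mtopology (T ^^ j)"
proof (induction j)
  case (Suc j)
  then show ?case
    using continuous_map_compose[OF Suc cont] by (simp add: o_def)
qed (simp add: id_def)

lemma iterate_in: "x \<in> X \<Longrightarrow> (T ^^ j) x \<in> X"
  using continuous_map_iterate[of j] by (auto simp: continuous_map_def)

lemma tendsto_dist_limitin:
  assumes "limitin mtopology u a F" "limitin mtopology v b F"
  shows "((\<lambda>k. d (u k) (v k)) \<longlongrightarrow> d a b) F"
proof -
  have a: "a \<in> X" "b \<in> X" and ev: "\<forall>\<^sub>F k in F. u k \<in> X" "\<forall>\<^sub>F k in F. v k \<in> X"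
    and lim: "((\<lambda>k. d (u k) a) \<longlongrightarrow> 0) F" "((\<lambda>k. d (v k) b) \<longlongrightarrow> 0) F"
    using assms by (auto simp: limitin_metric_dist_null)
  have "\<forall>\<^sub>F k in F. norm (d (u k) (v k) - d a b) \<le> d (u k) a + d (v k) b"
    using ev
  proof eventually_elim
    case (elim k)
    then show ?case
      using a triangle[of "u k" a "v k"] triangle[of a b "v k"] triangle[of a "u k" b]
        triangle[of "u k" "v k" b]
      by (auto simp: commute abs_if)
  qed
  moreover have "((\<lambda>k. d (u k) a + d (v k) b) \<longlongrightarrow> 0) F"
    using tendsto_add[OF lim] by simp
  ultimately have "((\<lambda>k. d (u k) (v k) - d a b) \<longlongrightarrow> 0) F"
    by (rule Lim_null_comparison)
  then show ?thesis
    by (simp add: LIM_zero_iff)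
qed

text \<open>Separate exponents serve the comparison of a centre at time \<open>j\<close> with a
  point at time \<open>j + n\<close>.\<close>

lemma tendsto_dist_iterate:
  assumes "limitin mtopology u a F" "limitin mtopology v b F"
  shows "((\<lambda>k. d ((T ^^ i) (u k)) ((T ^^ j) (v k))) \<longlongrightarrow> d ((T ^^ i) a) ((T ^^ j) b)) F"
  using tendsto_dist_limitin continuous_map_limit[OF continuous_map_iterate assms(1)]
    continuous_map_limit[OF continuous_map_iterate assms(2)]
  by (fastforce simp: o_def)

lemma convergent_subsequence:
  assumes "\<And>k::nat. u k \<in> X"
  obtains a r where "a \<in> X" "strict_mono r" "limitin mtopology (u \<circ> r) a sequentially"
  using compact_X assms unfolding compact_space_sequentially by (metis image_subsetI)

section \<open>Compactness: finite stable times and finite covers\<close>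

text \<open>Compactness makes \<open>m\<close> uniform in the centre. If every \<open>m\<close>
  failed, bad centres and bad points would converge along a subsequence. The limit point satisfies
  all the closed constraints, so a set \<open>E\<close> belonging to the limit centre spans it;
  being spanned is an open condition and would pass to the bad points. \<open>Q\<close> will be
  finiteness together with a weight bound.\<close>

lemma spanning_finite_stable_time:
  assumes "n > 0"
    and span: "\<And>y. y \<in> X \<Longrightarrow> \<exists>E. spanning X T ((T ^^ n) -` stable_set X d T \<epsilon> y \<inter> X) d n \<delta> E \<and> Q E"
  shows "\<exists>m. \<forall>y\<in>X. \<exists>E.
    spanning X T {x \<in> X. \<forall>j<m. d ((T ^^ j) y) ((T ^^ (j + n)) x) \<le> \<epsilon>} d n \<delta> E \<and> Q E"
proof (rule ccontr)
  assume "\<not> ?thesis"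
  then have "\<forall>m. \<exists>y. y \<in> X \<and> (\<forall>E. Q E \<longrightarrow>
      \<not> spanning X T {x \<in> X. \<forall>j<m. d ((T ^^ j) y) ((T ^^ (j + n)) x) \<le> \<epsilon>} d n \<delta> E)"
    by blast
  from choice[OF this] obtain y where y: "\<And>m. y m \<in> X"
    and neg: "\<And>m E. Q E \<Longrightarrow>
      \<not> spanning X T {x \<in> X. \<forall>j<m. d ((T ^^ j) (y m)) ((T ^^ (j + n)) x) \<le> \<epsilon>} d n \<delta> E"
    by blast
  \<comment> \<open>The centres come first: \<open>E\<close> is determined by their limit
    \<open>b\<close>, and only then can points missed by \<open>E\<close> be chosen.\<close>
  obtain b r where b: "b \<in> X" "strict_mono r" "limitin mtopology (y \<circ> r) b sequentially"
    using convergent_subsequence[of y] y by blast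
  obtain E where E: "spanning X T ((T ^^ n) -` stable_set X d T \<epsilon> b \<inter> X) d n \<delta> E" "Q E"
    using span b(1) by blast
  then have "E \<subseteq> X"
    by (simp add: spanning_def)
  have "\<forall>m. \<exists>x. x \<in> X \<and> (\<forall>j<m. d ((T ^^ j) (y m)) ((T ^^ (j + n)) x) \<le> \<epsilon>) \<and>
      (\<forall>e\<in>E. \<exists>j<n. \<not> d ((T ^^ j) x) ((T ^^ j) e) < \<delta>)"
  proof
    fix m
    have "\<not> (\<forall>x\<in>{x \<in> X. \<forall>j<m. d ((T ^^ j) (y m)) ((T ^^ (j + n)) x) \<le> \<epsilon>}.
        \<exists>e\<in>E. \<forall>j<n. d ((T ^^ j) x) ((T ^^ j) e) < \<delta>)"
      using neg[OF E(2), of m] \<open>E \<subseteq> X\<close> unfolding spanning_def bowen_dist_less_iff[OF assms(1)]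
      by simp
    then show "\<exists>x. x \<in> X \<and> (\<forall>j<m. d ((T ^^ j) (y m)) ((T ^^ (j + n)) x) \<le> \<epsilon>) \<and>
        (\<forall>e\<in>E. \<exists>j<n. \<not> d ((T ^^ j) x) ((T ^^ j) e) < \<delta>)"
      by simp
  qed
  from choice[OF this] obtain x where x_all: "\<forall>m. x m \<in> X \<and>
      (\<forall>j<m. d ((T ^^ j) (y m)) ((T ^^ (j + n)) (x m)) \<le> \<epsilon>) \<and>
      (\<forall>e\<in>E. \<exists>j<n. \<not> d ((T ^^ j) (x m)) ((T ^^ j) e) < \<delta>)" ..
  then have x: "x m \<in> X" for m
    by simp
  have close: "d ((T ^^ j) (y m)) ((T ^^ (j + n)) (x m)) \<le> \<epsilon>" if "j < m" for m j
    using x_all that by simp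
  have far: "\<exists>j<n. \<not> d ((T ^^ j) (x m)) ((T ^^ j) e) < \<delta>" if "e \<in> E" for m e
    using x_all that by simp
  obtain a s where a: "a \<in> X" "strict_mono s" "limitin mtopology ((x \<circ> r) \<circ> s) a sequentially"
    using convergent_subsequence[of "x \<circ> r"] x by auto
  have lim_y: "limitin mtopology ((y \<circ> r) \<circ> s) b sequentially"
    by (rule limitin_subsequence[OF a(2) b(3)])
  have "d ((T ^^ j) b) ((T ^^ (j + n)) a) \<le> \<epsilon>" for j
  proof (rule tendsto_upperbound[OF tendsto_dist_iterate[OF lim_y a(3), of j "j + n"]])
    \<comment> \<open>The constraint at time \<open>j\<close> holds only for indices above
      \<open>j\<close>; the subsequence \<open>r \<circ> s\<close> eventually exceeds
      \<open>j\<close>.\<close>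
    have "strict_mono (r \<circ> s)"
      by (rule strict_mono_o[OF b(2) a(2)])
    then have "j < r (s k)" if "k > j" for k
      using that seq_suble[of "r \<circ> s" k] by simp
    then show "\<forall>\<^sub>F k in sequentially.
        d ((T ^^ j) (((y \<circ> r) \<circ> s) k)) ((T ^^ (j + n)) (((x \<circ> r) \<circ> s) k)) \<le> \<epsilon>"
      by (intro eventually_sequentiallyI[of "Suc j"]) (simp add: close)
  qed simp
  then have "a \<in> (T ^^ n) -` stable_set X d T \<epsilon> b \<inter> X"
    using a(1) by (simp add: stable_set_def iterate_in funpow_add)
  with E(1) have "\<exists>e\<in>E. bowen_dist T d n a e < \<delta>"
    unfolding spanning_def by (elim conjE bspec)
  \<comment> \<open>A single \<open>e\<close> is close to the limit in finitely many strict
    inequalities, which therefore hold far along the sequence, even if \<open>E\<close> is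
    infinite.\<close>
  then obtain e where e: "e \<in> E" "\<And>j. j < n \<Longrightarrow> d ((T ^^ j) a) ((T ^^ j) e) < \<delta>"
    unfolding bowen_dist_less_iff[OF assms(1)] by blast
  have lim_e: "limitin mtopology (\<lambda>k. e) e sequentially"
    using e(1) \<open>E \<subseteq> X\<close> by (auto simp: limitin_const_iff)
  have "\<forall>\<^sub>F k in sequentially. \<forall>j\<in>{..<n}.
      d ((T ^^ j) (((x \<circ> r) \<circ> s) k)) ((T ^^ j) e) < \<delta>"
  proof (rule eventually_ball_finite)
    show "\<forall>j\<in>{..<n}. \<forall>\<^sub>F k in sequentially. d ((T ^^ j) (((x \<circ> r) \<circ> s) k)) ((T ^^ j) e) < \<delta>"
      using order_tendstoD(2)[OF tendsto_dist_iterate[OF a(3) lim_e]] e(2) by auto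
  qed simp
  from eventually_happens'[OF sequentially_bot this]
  obtain k where "\<forall>j<n. d ((T ^^ j) (x (r (s k)))) ((T ^^ j) e) < \<delta>"
    by auto
  with far[OF e(1), of "r (s k)"] show False
    by blast
qed

text \<open>Open Bowen balls of length \<open>m\<close> and radius \<open>\<epsilon> / 2\<close>
  cover \<open>X\<close>; a finite subcover does it.\<close>

lemma finite_cover_small_bowen_diameter:
  assumes "\<epsilon> > 0"
  shows "\<exists>\<A>. finite \<A> \<and> X = \<Union>\<A> \<and>
    (\<forall>A\<in>\<A>. \<forall>x\<in>A. \<forall>y\<in>A. \<forall>j<m. d ((T ^^ j) x) ((T ^^ j) y) \<le> \<epsilon>)"
proof -
  \<comment> \<open>The factor \<open>X\<close> matters for \<open>m = 0\<close>, where the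
    intersection over the empty family is the whole type.\<close>
  define U where "U z = (\<Inter>j<m. {x \<in> X. (T ^^ j) x \<in> mball ((T ^^ j) z) (\<epsilon> / 2)}) \<inter> X" for z
  have "openin mtopology (U z)" for z
  proof -
    have "openin mtopology {x \<in> X. (T ^^ j) x \<in> mball ((T ^^ j) z) (\<epsilon> / 2)}" for j
      using openin_continuous_map_preimage[OF continuous_map_iterate, of "mball ((T ^^ j) z) (\<epsilon> / 2)" j]
      by simp
    then show ?thesis
      using openin_INT[of "{..<m}" mtopology "\<lambda>j. {x \<in> X. (T ^^ j) x \<in> mball ((T ^^ j) z) (\<epsilon> / 2)}"]
      unfolding U_def topspace_mtopology by blast
  qed
  moreover have "X \<subseteq> \<Union> (U ` X)"
    using assms by (auto simp: U_def iterate_in)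
  ultimately obtain \<A> where \<A>: "finite \<A>" "\<A> \<subseteq> U ` X" "X \<subseteq> \<Union>\<A>"
    using compact_X unfolding compact_space_alt by (metis (no_types, lifting) image_iff topspace_mtopology)
  have "d ((T ^^ j) x) ((T ^^ j) y) \<le> \<epsilon>" if "x \<in> U z" "y \<in> U z" "j < m" for x y z j
    using that triangle[of "(T ^^ j) x" "(T ^^ j) z" "(T ^^ j) y"] by (force simp: U_def commute)
  moreover have "\<Union>\<A> \<subseteq> X"
    using \<A>(2) by (auto simp: U_def)
  ultimately show ?thesis
    using \<A> by (intro exI[of _ \<A>]) blast
qed

section \<open>Bounds on the potential and on weights\<close>

lemma continuous_bounded:
  assumes "continuous_map mtopology euclideanreal f"
  obtains B where "B \<ge> 0" "\<And>x. x \<in> X \<Longrightarrow> \<bar>f x\<bar> \<le> B"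
proof -
  have "compactin mtopology X"
    using compact_X by (simp add: compact_space_def)
  then have "compact (f ` X)"
    using image_compactin[OF _ assms] by simp
  then have "bounded (f ` X)"
    by (rule compact_imp_bounded)
  then obtain B where B: "\<And>x. x \<in> X \<Longrightarrow> \<bar>f x\<bar> \<le> B"
    by (auto simp: bounded_iff)
  \<comment> \<open>For empty \<open>X\<close> the bound obtained may be negative, hence the
    absolute value.\<close>
  show thesis
    by (rule that[of "\<bar>B\<bar>"]) (use B in force)+
qed

text \<open>This is the Heine-Cantor theorem on the compact space \<open>X\<close>.\<close>

lemma continuous_uniformly:
  assumes f: "continuous_map mtopology euclideanreal f" and "\<eta> > 0"
  obtains \<delta> where "\<delta> > 0" "\<And>x y. x \<in> X \<Longrightarrow> y \<in> X \<Longrightarrow> d x y < \<delta> \<Longrightarrow> \<bar>f x - f y\<bar> < \<eta>"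
proof -
  have "continuous_map (mtopology_of (metric (X, d))) (mtopology_of euclidean_metric) f"
    using f by (simp add: mtopology_of_def)
  then have "uniformly_continuous_map (metric (X, d)) euclidean_metric f"
    using compact_X by (intro continuous_imp_uniformly_continuous_map) (auto simp: mtopology_of_def)
  then obtain \<delta> where "\<delta> > 0" "\<And>x y. x \<in> X \<Longrightarrow> y \<in> X \<Longrightarrow> d y x < \<delta> \<Longrightarrow> \<bar>f y - f x\<bar> < \<eta>"
    using \<open>\<eta> > 0\<close> unfolding uniformly_continuous_map_def by (auto simp: dist_real_def)
  then show thesis
    using that by blast
qed

lemma abs_birkhoff_sum_le:
  assumes "\<And>x. x \<in> X \<Longrightarrow> \<bar>f x\<bar> \<le> B" "x \<in> X"
  shows "\<bar>birkhoff_sum T f n x\<bar> \<le> n * B"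
proof -
  have "\<bar>birkhoff_sum T f n x\<bar> \<le> (\<Sum>j<n. \<bar>f ((T ^^ j) x)\<bar>)"
    unfolding birkhoff_sum_def by (rule sum_abs)
  also have "\<dots> \<le> (\<Sum>j<n. B)"
    using assms by (intro sum_mono) (simp add: iterate_in)
  finally show ?thesis
    by simp
qed

text \<open>Two costs per time step: moving from \<open>x\<close> to \<open>y\<close> changes the
  Birkhoff sum by at most \<open>\<eta>\<close> a step, giving the factor
  \<open>(1 / \<delta>) powr \<eta>\<close>; doubling the scale in the base gives
  \<open>2 powr (- birkhoff_sum T f n x)\<close>, which is at most \<open>2 powr B\<close> a
  step.\<close>

lemma weight_double_scale:
  assumes B: "\<And>x. x \<in> X \<Longrightarrow> \<bar>f x\<bar> \<le> B"
    and \<eta>: "\<And>x y. x \<in> X \<Longrightarrow> y \<in> X \<Longrightarrow> d x y < \<delta> \<Longrightarrow> \<bar>f x - f y\<bar> < \<eta>"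
    and \<delta>: "0 < \<delta>" "\<delta> < 1"
    and x: "x \<in> X" "y \<in> X" "\<And>j. j < n \<Longrightarrow> d ((T ^^ j) x) ((T ^^ j) y) < \<delta>"
  shows "(1 / (2 * \<delta>)) powr birkhoff_sum T f n x
    \<le> (1 / \<delta>) powr birkhoff_sum T f n y * ((1 / \<delta>) powr \<eta> * 2 powr B) ^ n"
proof -
  have "birkhoff_sum T f n x - birkhoff_sum T f n y = (\<Sum>j<n. f ((T ^^ j) x) - f ((T ^^ j) y))"
    by (simp add: birkhoff_sum_def sum_subtractf)
  also have "\<dots> \<le> (\<Sum>j<n. \<eta>)"
    using \<eta> x by (intro sum_mono) (smt (verit) iterate_in lessThan_iff)
  finally have diff: "birkhoff_sum T f n x \<le> birkhoff_sum T f n y + n * \<eta>"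
    by simp
  have "(1 / (2 * \<delta>)) powr birkhoff_sum T f n x
      = (1 / \<delta>) powr birkhoff_sum T f n x * 2 powr (- birkhoff_sum T f n x)"
    using \<delta> by (simp add: powr_divide powr_mult powr_minus field_simps)
  also have "\<dots> \<le> (1 / \<delta>) powr (birkhoff_sum T f n y + n * \<eta>) * 2 powr (n * B)"
    using \<delta> diff abs_birkhoff_sum_le[of f B x n] B x(1) by (intro mult_mono powr_mono) auto
  also have "\<dots> = (1 / \<delta>) powr birkhoff_sum T f n y * ((1 / \<delta>) powr \<eta> * 2 powr B) ^ n"
    using \<delta> by (simp add: powr_add power_mult_distrib powr_power mult.commute)
  finally show ?thesis .
qed

text \<open>Since \<open>f\<close> is bounded, all weights exceed a common positive constant, so an
  infinite spanning set has infinite weight.\<close>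

lemma finite_spanning_of_press_sum_less:
  assumes B: "\<And>x. x \<in> X \<Longrightarrow> \<bar>f x\<bar> \<le> B"
    and \<delta>: "0 < \<delta>" "\<delta> < 1" and K: "press_sum X T f Z d \<delta> n < ennreal K"
  shows "\<exists>E. spanning X T Z d n \<delta> E \<and> finite E \<and> (\<Sum>x\<in>E. (1 / \<delta>) powr birkhoff_sum T f n x) \<le> K"
proof -
  obtain E where E: "spanning X T Z d n \<delta> E"
    "(\<Sum>\<^sub>\<infinity>x\<in>E. ennreal ((1 / \<delta>) powr birkhoff_sum T f n x)) < ennreal K"
    using K unfolding press_sum_def INF_less_iff by blast
  have "finite E"
  proof (rule ccontr)
    assume "infinite E"
    have "ennreal ((1 / \<delta>) powr (- (n * B))) \<le> ennreal ((1 / \<delta>) powr birkhoff_sum T f n x)"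
      if "x \<in> E" for x
      using abs_birkhoff_sum_le[of f B x n] B that E(1) \<delta>
      by (intro ennreal_leI powr_mono) (auto simp: spanning_def)
    then have "(\<Sum>\<^sub>\<infinity>x\<in>E. ennreal ((1 / \<delta>) powr birkhoff_sum T f n x)) = \<infinity>"
      by (rule infsum_superconst_infinite_ennreal) (use \<open>infinite E\<close> \<delta> in auto)
    then show False
      using E(2) by simp
  qed
  moreover from this have "ennreal (\<Sum>x\<in>E. (1 / \<delta>) powr birkhoff_sum T f n x) < ennreal K"
    using E(2) by simp
  ultimately show ?thesis
    using E(1) by (auto simp: ennreal_less_iff sum_nonneg intro!: exI[of _ E])
qed

section \<open>Iteration backwards in time\<close>

text \<open>Induction on \<open>k\<close> for all \<open>A\<close> at once: the one-block spanning
  set \<open>E\<close> cuts the preimage of \<open>A\<close> into pieces \<open>C e\<close> that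
  satisfy the same diameter hypothesis, so the induction hypothesis applies to each piece. Requiring
  the new points to lie in the preimage itself keeps the scale at \<open>2 * \<delta>\<close> for
  every \<open>k\<close>.\<close>

lemma spanning_iterated_preimage:
  fixes f :: "'a \<Rightarrow> real"
  assumes B: "\<And>x. x \<in> X \<Longrightarrow> \<bar>f x\<bar> \<le> B"
    and \<eta>: "\<And>x y. x \<in> X \<Longrightarrow> y \<in> X \<Longrightarrow> d x y < \<delta> \<Longrightarrow> \<bar>f x - f y\<bar> < \<eta>"
    and \<delta>: "0 < \<delta>" "\<delta> < 1" "2 * \<delta> \<le> \<epsilon>" and "n > 0" "K > 0"
    and span: "\<And>y. y \<in> X \<Longrightarrow> \<exists>E.
      spanning X T {x \<in> X. \<forall>j<m. d ((T ^^ j) y) ((T ^^ (j + n)) x) \<le> \<epsilon>} d n \<delta> E \<and>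
      finite E \<and> (\<Sum>x\<in>E. (1 / \<delta>) powr birkhoff_sum T f n x) \<le> K"
  shows "A \<subseteq> X \<Longrightarrow> \<forall>x\<in>A. \<forall>y\<in>A. \<forall>j<m. d ((T ^^ j) x) ((T ^^ j) y) \<le> \<epsilon> \<Longrightarrow>
    \<exists>E. finite E \<and> E \<subseteq> {x \<in> X. (T ^^ (k * n)) x \<in> A} \<and>
      (\<forall>x\<in>X. (T ^^ (k * n)) x \<in> A \<longrightarrow> (\<exists>z\<in>E. \<forall>j<k * n. d ((T ^^ j) x) ((T ^^ j) z) < 2 * \<delta>)) \<and>
      (\<Sum>x\<in>E. (1 / (2 * \<delta>)) powr birkhoff_sum T f (k * n) x)
        \<le> (K * ((1 / \<delta>) powr \<eta> * 2 powr B) ^ n) ^ k"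
proof (induction k arbitrary: A)
  case 0
  \<comment> \<open>There is no time to control, so any point of \<open>A\<close> will do, with
    weight 1.\<close>
  show ?case
  proof (cases "A = {}")
    case False
    then obtain a where "a \<in> A"
      by blast
    then show ?thesis
      using 0(1) \<delta> by (intro exI[of _ "{a}"]) (auto simp: birkhoff_sum_def)
  qed auto
next
  case (Suc k)
  define L where "L = (1 / \<delta>) powr \<eta> * 2 powr B"
  have "L > 0"
    using \<delta> by (simp add: L_def)
  show ?case
  proof (cases "A = {}")
    case True
    then show ?thesis
      using \<open>L > 0\<close> \<open>K > 0\<close> by (intro exI[of _ "{}"]) (simp add: L_def[symmetric])
  next
    case False
    \<comment> \<open>Any point of \<open>A\<close> can serve as centre: by the diameter hypothesis,
      the ball around it contains all of \<open>A\<close>.\<close>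
    then obtain y where y: "y \<in> A" "y \<in> X"
      using Suc.prems by blast
    obtain E where E: "spanning X T {x \<in> X. \<forall>j<m. d ((T ^^ j) y) ((T ^^ (j + n)) x) \<le> \<epsilon>} d n \<delta> E"
      "finite E" and weight_E: "(\<Sum>x\<in>E. (1 / \<delta>) powr birkhoff_sum T f n x) \<le> K"
      using span[OF y(2)] by blast
    define C where "C e = {x \<in> X. (T ^^ n) x \<in> A \<and> (\<forall>j<n. d ((T ^^ j) x) ((T ^^ j) e) < \<delta>)}" for e
    have C_diam: "d ((T ^^ j) u) ((T ^^ j) v) < 2 * \<delta>"
      if "e \<in> E" "u \<in> C e" "v \<in> C e" "j < n" for e u v j
    proof -
      have "e \<in> X" "u \<in> X" "v \<in> X"
        using E(1) that by (auto simp: spanning_def C_def)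
      moreover have "d ((T ^^ j) u) ((T ^^ j) e) < \<delta>" "d ((T ^^ j) v) ((T ^^ j) e) < \<delta>"
        using that by (auto simp: C_def)
      ultimately show ?thesis
        using triangle[of "(T ^^ j) u" "(T ^^ j) e" "(T ^^ j) v"]
        by (simp add: iterate_in commute)
    qed
    \<comment> \<open>Times below \<open>n\<close> are controlled through the common centre
      \<open>e\<close> and \<open>2 * \<delta> \<le> \<epsilon>\<close>; a time
      \<open>j \<ge> n\<close> is time \<open>j - n < m\<close> for two points of
      \<open>A\<close>.\<close>
    have C_small: "d ((T ^^ j) u) ((T ^^ j) v) \<le> \<epsilon>"
      if "e \<in> E" "u \<in> C e" "v \<in> C e" "j < m" for e u v j
    proof (cases "j < n")
      case False
      then have "(T ^^ j) x = (T ^^ (j - n)) ((T ^^ n) x)" for x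
        by (simp flip: funpow_add comp_apply[of "T ^^ (j - n)"])
      then show ?thesis
        using Suc.prems(2) that by (auto simp: C_def)
    qed (use C_diam[OF that(1-3)] \<delta>(3) in force)
    have "\<exists>E'. finite E' \<and> E' \<subseteq> {x \<in> X. (T ^^ (k * n)) x \<in> C e} \<and>
      (\<forall>x\<in>X. (T ^^ (k * n)) x \<in> C e \<longrightarrow> (\<exists>z\<in>E'. \<forall>j<k * n. d ((T ^^ j) x) ((T ^^ j) z) < 2 * \<delta>)) \<and>
      (\<Sum>x\<in>E'. (1 / (2 * \<delta>)) powr birkhoff_sum T f (k * n) x) \<le> (K * L ^ n) ^ k"
      (is "\<exists>E'. ?good e E'") if "e \<in> E" for e
      unfolding L_def
    proof (rule Suc.IH)
      show "C e \<subseteq> X"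
        by (auto simp: C_def)
      show "\<forall>x\<in>C e. \<forall>y\<in>C e. \<forall>j<m. d ((T ^^ j) x) ((T ^^ j) y) \<le> \<epsilon>"
        using C_small[OF that] by blast
    qed
    then have "\<exists>G. \<forall>e\<in>E. ?good e (G e)"
      by (intro bchoice ballI)
    then obtain G where good: "\<forall>e\<in>E. ?good e (G e)" ..
    have G: "finite (G e)" "G e \<subseteq> {x \<in> X. (T ^^ (k * n)) x \<in> C e}"
      "\<forall>x\<in>X. (T ^^ (k * n)) x \<in> C e \<longrightarrow> (\<exists>z\<in>G e. \<forall>j<k * n. d ((T ^^ j) x) ((T ^^ j) z) < 2 * \<delta>)"
      "(\<Sum>x\<in>G e. (1 / (2 * \<delta>)) powr birkhoff_sum T f (k * n) x) \<le> (K * L ^ n) ^ k" if "e \<in> E" for e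
      using bspec[OF good that] by - (elim conjE; assumption)+
    have split: "(T ^^ (i + k * n)) x = (T ^^ i) ((T ^^ (k * n)) x)" for i x
      by (simp add: funpow_add)
    show ?thesis
    proof (intro exI[of _ "\<Union>e\<in>E. G e"] conjI ballI impI)
      show "finite (\<Union>e\<in>E. G e)"
        using E(2) G(1) by blast
      show "(\<Union>e\<in>E. G e) \<subseteq> {x \<in> X. (T ^^ (Suc k * n)) x \<in> A}"
        using G(2) by (auto simp: split C_def)
      show "\<exists>z\<in>\<Union>e\<in>E. G e. \<forall>j<Suc k * n. d ((T ^^ j) x) ((T ^^ j) z) < 2 * \<delta>"
        if x: "x \<in> X" "(T ^^ (Suc k * n)) x \<in> A" for x
      proof -
        define x' where "x' = (T ^^ (k * n)) x"
        have x': "x' \<in> X" "(T ^^ n) x' \<in> A"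
          using x by (auto simp: x'_def split iterate_in)
        have "d ((T ^^ j) y) ((T ^^ (j + n)) x') \<le> \<epsilon>" if "j < m" for j
          using Suc.prems(2) y(1) x'(2) that by (simp add: funpow_add)
        then obtain e where e: "e \<in> E" "\<forall>j<n. d ((T ^^ j) x') ((T ^^ j) e) < \<delta>"
          using E(1) x'(1) unfolding spanning_def bowen_dist_less_iff[OF \<open>n > 0\<close>] by blast
        then have x'_C: "x' \<in> C e"
          using x' by (simp add: C_def)
        then obtain z where z: "z \<in> G e" "\<forall>j<k * n. d ((T ^^ j) x) ((T ^^ j) z) < 2 * \<delta>"
          using bspec[OF G(3)[OF e(1)] x(1)] unfolding x'_def by blast
        have "d ((T ^^ j) x) ((T ^^ j) z) < 2 * \<delta>" if "j < Suc k * n" for j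
        proof (cases "j < k * n")
          case False
          define i where "i = j - k * n"
          have i: "j = i + k * n" "i < n"
            using False that by (auto simp: i_def)
          \<comment> \<open>In the last block of times, the images of \<open>x\<close> and
            \<open>z\<close> start in the same piece \<open>C e\<close>.\<close>
          have "(T ^^ (k * n)) z \<in> C e"
            using G(2)[OF e(1)] z(1) by blast
          from C_diam[OF e(1) x'_C this i(2)] show ?thesis
            unfolding i(1) split x'_def .
        qed (use z in blast)
        then show ?thesis
          using e(1) z(1) by blast
      qed
      \<comment> \<open>The first \<open>k\<close> blocks keep their weight at scale
        \<open>2 * \<delta>\<close>; the last block is compared with the centre \<open>e\<close> at
        scale \<open>\<delta>\<close>.\<close>
      have "(1 / (2 * \<delta>)) powr birkhoff_sum T f (Suc k * n) x
          \<le> (1 / (2 * \<delta>)) powr birkhoff_sum T f (k * n) x *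
            ((1 / \<delta>) powr birkhoff_sum T f n e * L ^ n)"
        if "e \<in> E" "x \<in> G e" for e x
      proof -
        have "e \<in> X" "(T ^^ (k * n)) x \<in> C e"
          using that E(1) G(2) by (auto simp: spanning_def)
        then have "(1 / (2 * \<delta>)) powr birkhoff_sum T f n ((T ^^ (k * n)) x)
            \<le> (1 / \<delta>) powr birkhoff_sum T f n e * L ^ n"
          unfolding L_def by (intro weight_double_scale[OF B \<eta> \<delta>(1,2)]) (auto simp: C_def)
        moreover have "birkhoff_sum T f (Suc k * n) x
            = birkhoff_sum T f (k * n) x + birkhoff_sum T f n ((T ^^ (k * n)) x)"
          using birkhoff_sum_add[of T f "k * n" n x] by (simp add: add.commute)
        ultimately show ?thesis
          by (simp add: powr_add mult_left_mono)
      qed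
      then have "(\<Sum>e\<in>E. \<Sum>x\<in>G e. (1 / (2 * \<delta>)) powr birkhoff_sum T f (Suc k * n) x)
          \<le> (\<Sum>e\<in>E. \<Sum>x\<in>G e. (1 / (2 * \<delta>)) powr birkhoff_sum T f (k * n) x *
            ((1 / \<delta>) powr birkhoff_sum T f n e * L ^ n))"
        by (intro sum_mono) auto
      \<comment> \<open>The factor of the last block depends on \<open>e\<close> only, so the inner
        sum falls to the induction hypothesis; the remaining sum over \<open>E\<close> is at most
        \<open>K\<close>.\<close>
      also have "\<dots> \<le> (\<Sum>e\<in>E. (K * L ^ n) ^ k * ((1 / \<delta>) powr birkhoff_sum T f n e * L ^ n))"
        unfolding sum_distrib_right[symmetric] using G(4) \<open>L > 0\<close>
        by (intro sum_mono mult_right_mono) auto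
      also have "\<dots> = (K * L ^ n) ^ k * L ^ n * (\<Sum>e\<in>E. (1 / \<delta>) powr birkhoff_sum T f n e)"
        by (simp add: sum_distrib_left mult_ac)
      also have "\<dots> \<le> (K * L ^ n) ^ k * L ^ n * K"
        using weight_E \<open>L > 0\<close> \<open>K > 0\<close> by (intro mult_left_mono) auto
      finally have "(\<Sum>e\<in>E. \<Sum>x\<in>G e. (1 / (2 * \<delta>)) powr birkhoff_sum T f (Suc k * n) x)
          \<le> (K * L ^ n) ^ Suc k"
        by (simp add: mult_ac)
      moreover have "(\<Sum>x\<in>(\<Union>e\<in>E. G e). (1 / (2 * \<delta>)) powr birkhoff_sum T f (Suc k * n) x)
          \<le> (\<Sum>e\<in>E. \<Sum>x\<in>G e. (1 / (2 * \<delta>)) powr birkhoff_sum T f (Suc k * n) x)"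
        using E(2) G(1) by (intro sum_UNION_le) auto
      ultimately show "(\<Sum>x\<in>(\<Union>e\<in>E. G e). (1 / (2 * \<delta>)) powr birkhoff_sum T f (Suc k * n) x)
          \<le> (K * ((1 / \<delta>) powr \<eta> * 2 powr B) ^ n) ^ Suc k"
        by (simp add: L_def)
    qed
  qed
qed

section \<open>From one block length to the pressure of the space\<close>

text \<open>Round \<open>N\<close> up to a multiple of \<open>n\<close>, span the iterated preimage
  of each set of a finite cover, and truncate the weights to length \<open>N\<close>. The size of
  the cover and the cost of truncation do not depend on \<open>N\<close>, so only the rate per block
  survives in the limit.\<close>

lemma press_le_of_spanning:
  fixes f :: "'a \<Rightarrow> real"
  assumes B: "\<And>x. x \<in> X \<Longrightarrow> \<bar>f x\<bar> \<le> B"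
    and \<eta>: "\<And>x y. x \<in> X \<Longrightarrow> y \<in> X \<Longrightarrow> d x y < \<delta> \<Longrightarrow> \<bar>f x - f y\<bar> < \<eta>"
    and \<delta>: "0 < \<delta>" "2 * \<delta> < 1" "2 * \<delta> \<le> \<epsilon>" and "n > 0" "K > 0" "B \<ge> 0"
    and span: "\<And>y. y \<in> X \<Longrightarrow> \<exists>E.
      spanning X T {x \<in> X. \<forall>j<m. d ((T ^^ j) y) ((T ^^ (j + n)) x) \<le> \<epsilon>} d n \<delta> E \<and>
      finite E \<and> (\<Sum>x\<in>E. (1 / \<delta>) powr birkhoff_sum T f n x) \<le> K"
  shows "press X T f X d (2 * \<delta>) \<le> ereal (ln K / n + \<eta> * ln (1 / \<delta>) + B * ln 2)"
proof -
  define L where "L = (1 / \<delta>) powr \<eta> * 2 powr B"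
  \<comment> \<open>\<open>V\<close> bounds the weight factor of one block, \<open>D\<close> the
    cost of cutting off less than one block.\<close>
  define V where "V = K * L ^ n"
  define D where "D = (1 / (2 * \<delta>)) powr (n * B)"
  have pos: "L > 0" "V > 0" "D > 0"
    using \<delta> \<open>K > 0\<close> by (simp_all add: L_def V_def D_def)
  obtain \<A> where \<A>: "finite \<A>" "X = \<Union>\<A>"
    "\<And>A. A \<in> \<A> \<Longrightarrow> \<forall>x\<in>A. \<forall>y\<in>A. \<forall>j<m. d ((T ^^ j) x) ((T ^^ j) y) \<le> \<epsilon>"
    using finite_cover_small_bowen_diameter[of \<epsilon> m] \<delta> by auto
  \<comment> \<open>The added 1 keeps \<open>c\<close> positive, and \<open>ln c\<close> meaningful,
    for an empty cover.\<close>
  define c where "c = (card \<A> + 1) * D"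
  have "c > 0"
    using pos by (simp add: c_def)
  have bound: "ext_ln (press_sum X T f X d (2 * \<delta>) N) / ereal (real N)
      \<le> ereal ((ln c + \<bar>ln V\<bar>) / N + ln V / n)" if "N > 0" for N
  proof -
    \<comment> \<open>This is \<open>N / n\<close> rounded up, so that control over
      \<open>q * n\<close> times includes the first \<open>N\<close>.\<close>
    define q where "q = (N + n - 1) div n"
    have q: "N \<le> q * n" "q * n < N + n"
    proof -
      have "(N + n - 1) mod n < n" "q * n + (N + n - 1) mod n = N + n - 1"
        using \<open>n > 0\<close> by (simp_all add: q_def)
      then show "N \<le> q * n" "q * n < N + n"
        using \<open>n > 0\<close> by linarith+
    qed
    have "\<exists>E. finite E \<and> E \<subseteq> {x \<in> X. (T ^^ (q * n)) x \<in> A} \<and>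
      (\<forall>x\<in>X. (T ^^ (q * n)) x \<in> A \<longrightarrow> (\<exists>z\<in>E. \<forall>j<q * n. d ((T ^^ j) x) ((T ^^ j) z) < 2 * \<delta>)) \<and>
      (\<Sum>x\<in>E. (1 / (2 * \<delta>)) powr birkhoff_sum T f (q * n) x) \<le> V ^ q"
      (is "\<exists>E. ?good A E") if "A \<in> \<A>" for A
      unfolding V_def L_def
    proof (rule spanning_iterated_preimage[where f = f and B = B and \<eta> = \<eta> and \<delta> = \<delta> and \<epsilon> = \<epsilon> and m = m])
      show "A \<subseteq> X"
        using \<A>(2) that by blast
      show "\<forall>x\<in>A. \<forall>y\<in>A. \<forall>j<m. d ((T ^^ j) x) ((T ^^ j) y) \<le> \<epsilon>"
        using \<A>(3) that by blast
    qed (fact | use \<delta> in linarith)+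
    then have "\<exists>G. \<forall>A\<in>\<A>. ?good A (G A)"
      by (intro bchoice ballI)
    then obtain G where good: "\<forall>A\<in>\<A>. ?good A (G A)" ..
    have G: "finite (G A)" "G A \<subseteq> {x \<in> X. (T ^^ (q * n)) x \<in> A}"
      "\<forall>x\<in>X. (T ^^ (q * n)) x \<in> A \<longrightarrow> (\<exists>z\<in>G A. \<forall>j<q * n. d ((T ^^ j) x) ((T ^^ j) z) < 2 * \<delta>)"
      "(\<Sum>x\<in>G A. (1 / (2 * \<delta>)) powr birkhoff_sum T f (q * n) x) \<le> V ^ q" if "A \<in> \<A>" for A
      using bspec[OF good that] by - (elim conjE; assumption)+
    define E where "E = (\<Union>A\<in>\<A>. G A)"
    have "finite E" "E \<subseteq> X"
      unfolding E_def using \<A>(1) G(1) G(2) by (blast, blast)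
    have "\<exists>z\<in>E. bowen_dist T d N x z < 2 * \<delta>" if x: "x \<in> X" for x
    proof -
      obtain A where A: "A \<in> \<A>" "(T ^^ (q * n)) x \<in> A"
        using iterate_in[OF x, of "q * n"] \<A>(2) by auto
      show ?thesis
        using bspec[OF G(3)[OF A(1)] x] A(2) A(1) q(1) unfolding E_def bowen_dist_less_iff[OF \<open>N > 0\<close>]
        by (blast intro: less_le_trans)
    qed
    then have "spanning X T X d N (2 * \<delta>) E"
      using \<open>E \<subseteq> X\<close> by (simp add: spanning_def)
    then have "press_sum X T f X d (2 * \<delta>) N
        \<le> (\<Sum>\<^sub>\<infinity>x\<in>E. ennreal ((1 / (2 * \<delta>)) powr birkhoff_sum T f N x))"
      unfolding press_sum_def by (intro INF_lower) simp
    also have "\<dots> = ennreal (\<Sum>x\<in>E. (1 / (2 * \<delta>)) powr birkhoff_sum T f N x)"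
      using \<open>finite E\<close> by simp
    also have "\<dots> \<le> ennreal (c * V ^ q)"
    proof (rule ennreal_leI)
      \<comment> \<open>The tail that is cut off has at most \<open>n\<close> terms, so dropping it
        raises the Birkhoff sum by at most \<open>n * B\<close>.\<close>
      have "(1 / (2 * \<delta>)) powr birkhoff_sum T f N x
          \<le> (1 / (2 * \<delta>)) powr birkhoff_sum T f (q * n) x * D" if "x \<in> X" for x
      proof -
        define i where "i = q * n - N"
        have i: "q * n = N + i" "i \<le> n"
          using q by (auto simp: i_def)
        have "\<bar>birkhoff_sum T f i ((T ^^ N) x)\<bar> \<le> i * B"
          using B that by (intro abs_birkhoff_sum_le) (auto simp: iterate_in)
        also have "\<dots> \<le> n * B"
          using i(2) \<open>B \<ge> 0\<close> by (simp add: mult_right_mono)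
        finally have "birkhoff_sum T f N x \<le> birkhoff_sum T f (q * n) x + n * B"
          by (simp add: i(1) birkhoff_sum_add)
        then show ?thesis
          using \<delta> by (simp add: D_def flip: powr_add)
      qed
      then have "(\<Sum>x\<in>E. (1 / (2 * \<delta>)) powr birkhoff_sum T f N x)
          \<le> (\<Sum>x\<in>E. (1 / (2 * \<delta>)) powr birkhoff_sum T f (q * n) x) * D"
        unfolding sum_distrib_right using \<open>E \<subseteq> X\<close> by (intro sum_mono) blast
      also have "(\<Sum>x\<in>E. (1 / (2 * \<delta>)) powr birkhoff_sum T f (q * n) x)
          \<le> (\<Sum>A\<in>\<A>. \<Sum>x\<in>G A. (1 / (2 * \<delta>)) powr birkhoff_sum T f (q * n) x)"
        unfolding E_def using \<A>(1) G(1) by (intro sum_UNION_le) auto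
      also have "\<dots> \<le> (\<Sum>A\<in>\<A>. V ^ q)"
        using G(4) by (intro sum_mono)
      also have "\<dots> \<le> (card \<A> + 1) * V ^ q"
        using pos by (simp add: mult_right_mono)
      finally show "(\<Sum>x\<in>E. (1 / (2 * \<delta>)) powr birkhoff_sum T f N x) \<le> c * V ^ q"
        using pos by (simp add: c_def mult_ac)
    qed
    finally have "ext_ln (press_sum X T f X d (2 * \<delta>) N) \<le> ext_ln (ennreal (c * V ^ q))"
      by (rule ext_ln_mono)
    also have "\<dots> = ereal (ln c + q * ln V)"
      using \<open>c > 0\<close> pos by (subst ext_ln_ennreal) (simp_all add: ln_mult ln_realpow)
    also have "\<dots> \<le> ereal (((ln c + \<bar>ln V\<bar>) / N + ln V / n) * N)"
    proof -
      have "real N \<le> real q * real n" "real q * real n \<le> real N + real n"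
        using q by (simp_all flip: of_nat_mult of_nat_add)
      \<comment> \<open>\<open>ln V\<close> may have either sign, so the rounding error of at most 1
        in \<open>q\<close> costs \<open>\<bar>ln V\<bar>\<close>.\<close>
      then have "\<bar>real q - real N / real n\<bar> \<le> 1"
        using \<open>n > 0\<close> by (simp add: field_simps abs_le_iff)
      then have "\<bar>(real q - real N / real n) * ln V\<bar> \<le> \<bar>ln V\<bar>"
        unfolding abs_mult by (intro mult_left_le_one_le) auto
      then have "(real q - real N / real n) * ln V \<le> \<bar>ln V\<bar>"
        by linarith
      then have "ln c + q * ln V \<le> (ln c + \<bar>ln V\<bar>) + N / n * ln V"
        by (simp add: left_diff_distrib)
      also have "\<dots> = ((ln c + \<bar>ln V\<bar>) / N + ln V / n) * N"
        using \<open>N > 0\<close> \<open>n > 0\<close> by (simp add: field_simps)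
      finally show ?thesis
        by simp
    qed
    finally show ?thesis
      using \<open>N > 0\<close> by (subst ereal_divide_le_pos) (auto simp: mult.commute)
  qed
  have "(\<lambda>N. ereal ((ln c + \<bar>ln V\<bar>) / real N + ln V / n)) \<longlonglongrightarrow> ereal (0 + ln V / n)"
    by (intro tendsto_intros lim_const_over_n)
  then have "limsup (\<lambda>N. ereal ((ln c + \<bar>ln V\<bar>) / real N + ln V / n)) = ereal (ln V / n)"
    by (simp add: lim_imp_Limsup)
  then have "press X T f X d (2 * \<delta>) \<le> ereal (ln V / n)"
    unfolding press_def
    by (metis (no_types, lifting) Limsup_mono bound eventually_gt_at_top eventually_mono)
  also have "ln V / n = ln K / n + \<eta> * ln (1 / \<delta>) + B * ln 2"
  proof -
    have "ln L = \<eta> * ln (1 / \<delta>) + B * ln 2"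
      unfolding L_def using \<delta> by (subst ln_mult) auto
    moreover have "ln V = ln K + n * ln L"
      using \<open>K > 0\<close> pos by (simp add: V_def ln_mult ln_realpow)
    ultimately show ?thesis
      using \<open>n > 0\<close> by (simp add: add_divide_distrib)
  qed
  finally show ?thesis .
qed

text \<open>A single good \<open>n\<close> suffices, because iteration propagates its bound to all
  times; the hypothesis on the limsup supplies one, with \<open>K = exp (g * n)\<close>.\<close>

lemma press_le_growth_rate:
  fixes f :: "'a \<Rightarrow> real"
  assumes B: "\<And>x. x \<in> X \<Longrightarrow> \<bar>f x\<bar> \<le> B"
    and \<eta>: "\<And>x y. x \<in> X \<Longrightarrow> y \<in> X \<Longrightarrow> d x y < \<delta> \<Longrightarrow> \<bar>f x - f y\<bar> < \<eta>"
    and \<delta>: "0 < \<delta>" "2 * \<delta> < 1" "2 * \<delta> \<le> \<epsilon>" and "B \<ge> 0"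
    and g: "growth_rate (\<lambda>n. SUP x\<in>X.
        press_sum X T f ((T ^^ n) -` stable_set X d T \<epsilon> x \<inter> X) d \<delta> n) < ereal g"
  shows "press X T f X d (2 * \<delta>) \<le> ereal (g + \<eta> * ln (1 / \<delta>) + B * ln 2)"
proof -
  let ?p = "\<lambda>n. SUP x\<in>X. press_sum X T f ((T ^^ n) -` stable_set X d T \<epsilon> x \<inter> X) d \<delta> n"
  have "\<forall>\<^sub>F n in sequentially. ext_ln (?p n) / ereal (real n) < ereal g"
    using g unfolding growth_rate_def by (rule Limsup_lessD)
  from eventually_happens'[OF sequentially_bot eventually_conj[OF eventually_gt_at_top[of 0] this]]
  obtain n where n: "n > 0" "ext_ln (?p n) / ereal (real n) < ereal g"
    by blast
  then have "ext_ln (?p n) < ereal (g * n)"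
    by (simp add: ereal_divide_less_iff)
  then have p: "?p n < ennreal (exp (g * n))"
    by (rule less_ennreal_exp)
  have "\<exists>E. spanning X T ((T ^^ n) -` stable_set X d T \<epsilon> y \<inter> X) d n \<delta> E \<and>
      finite E \<and> (\<Sum>x\<in>E. (1 / \<delta>) powr birkhoff_sum T f n x) \<le> exp (g * n)" if "y \<in> X" for y
    using B \<delta> le_less_trans[OF SUP_upper[OF that] p]
    by (intro finite_spanning_of_press_sum_less) auto
  then obtain m where "\<forall>y\<in>X. \<exists>E.
    spanning X T {x \<in> X. \<forall>j<m. d ((T ^^ j) y) ((T ^^ (j + n)) x) \<le> \<epsilon>} d n \<delta> E \<and>
    finite E \<and> (\<Sum>x\<in>E. (1 / \<delta>) powr birkhoff_sum T f n x) \<le> exp (g * n)"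
    using spanning_finite_stable_time[OF n(1), of \<epsilon> \<delta>
        "\<lambda>E. finite E \<and> (\<Sum>x\<in>E. (1 / \<delta>) powr birkhoff_sum T f n x) \<le> exp (g * n)"] by blast
  then have span: "\<exists>E.
    spanning X T {x \<in> X. \<forall>j<m. d ((T ^^ j) y) ((T ^^ (j + n)) x) \<le> \<epsilon>} d n \<delta> E \<and>
    finite E \<and> (\<Sum>x\<in>E. (1 / \<delta>) powr birkhoff_sum T f n x) \<le> exp (g * n)" if "y \<in> X" for y
    using that by blast
  have "press X T f X d (2 * \<delta>) \<le> ereal (ln (exp (g * n)) / n + \<eta> * ln (1 / \<delta>) + B * ln 2)"
    by (rule press_le_of_spanning[where f = f and B = B and \<eta> = \<eta> and \<delta> = \<delta> and \<epsilon> = \<epsilon> and m = m])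
      (fact | simp)+
  then show ?thesis
    using n(1) by simp
qed

section \<open>The two inequalities between the mean dimensions\<close>

lemma upper_mdim_le:
  fixes f :: "'a \<Rightarrow> real"
  assumes f: "continuous_map mtopology euclideanreal f" and "\<epsilon> > 0"
  shows "upper_mdim X T f X d \<le> Limsup (at_right 0) (\<lambda>\<delta>.
      growth_rate (\<lambda>n. SUP x\<in>X.
        press_sum X T f ((T ^^ n) -` stable_set X d T \<epsilon> x \<inter> X) d \<delta> n) / ereal (ln (1 / \<delta>)))"
    (is "_ \<le> ?R")
proof (rule ereal_le_real)
  \<comment> \<open>Comparing with real upper bounds \<open>c\<close> of the right-hand side covers
    its infinite values too.\<close>
  fix c
  assume c: "?R \<le> ereal c"
  obtain B where B: "B \<ge> 0" "\<And>x. x \<in> X \<Longrightarrow> \<bar>f x\<bar> \<le> B"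
    using continuous_bounded[OF f] by blast
  have "upper_mdim X T f X d \<le> ereal c + ereal e" if "e > 0" for e
  proof -
    \<comment> \<open>Half of \<open>e\<close> is spent on the strict inequality above
      \<open>c\<close>, half on the oscillation of \<open>f\<close>.\<close>
    define \<eta> where "\<eta> = e / 2"
    have "\<eta> > 0"
      using that by (simp add: \<eta>_def)
    obtain r where r: "r > 0" "\<And>x y. x \<in> X \<Longrightarrow> y \<in> X \<Longrightarrow> d x y < r \<Longrightarrow> \<bar>f x - f y\<bar> < \<eta>"
      using continuous_uniformly[OF f \<open>\<eta> > 0\<close>] by blast
    have "?R < ereal (c + \<eta>)"
      using c \<open>\<eta> > 0\<close> by (simp add: le_less_trans)
    then have ev: "\<forall>\<^sub>F \<delta> in at_right 0. growth_rate (\<lambda>n. SUP x\<in>X.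
        press_sum X T f ((T ^^ n) -` stable_set X d T \<epsilon> x \<inter> X) d \<delta> n) / ereal (ln (1 / \<delta>))
        < ereal (c + \<eta>)" (is "\<forall>\<^sub>F \<delta> in _. ?g \<delta> / _ < _")
      by (rule Limsup_lessD)
    \<comment> \<open>Iteration doubles the scale, so the growth rate at \<open>\<delta> / 2\<close>
      controls the pressure at \<open>\<delta>\<close>.\<close>
    have half: "filterlim (\<lambda>\<delta>::real. \<delta> / 2) (at_right 0) (at_right 0)"
      by real_asymp
    have "\<forall>\<^sub>F \<delta> in at_right 0. \<delta> / 2 < r \<and> \<delta> < 1 \<and> \<delta> \<le> \<epsilon> \<and> \<delta> > 0"
      unfolding eventually_at_right_field
      using r(1) \<open>\<epsilon> > 0\<close> by (intro exI[of _ "min r (min 1 \<epsilon>)"]) auto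
    with eventually_compose_filterlim[OF ev half]
    have "\<forall>\<^sub>F \<delta> in at_right 0. press X T f X d \<delta> / ereal (ln (1 / \<delta>))
      \<le> ereal (((c + \<eta> + \<eta>) * ln (2 / \<delta>) + B * ln 2) / ln (1 / \<delta>))"
    proof eventually_elim
      case (elim \<delta>)
      have ln_pos: "ln (1 / \<delta>) > 0" "ln (2 / \<delta>) > 0"
        using elim by auto
      have "?g (\<delta> / 2) < ereal ((c + \<eta>) * ln (2 / \<delta>))"
        using elim ln_pos by (simp add: ereal_divide_less_iff)
      then have "press X T f X d (2 * (\<delta> / 2))
          \<le> ereal ((c + \<eta>) * ln (2 / \<delta>) + \<eta> * ln (1 / (\<delta> / 2)) + B * ln 2)"
        using elim r(2)
        by (intro press_le_growth_rate[where f = f and \<epsilon> = \<epsilon>, OF B(2) _ _ _ _ B(1)]) auto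
      also have "\<dots> = ereal ((c + \<eta> + \<eta>) * ln (2 / \<delta>) + B * ln 2)"
        by (simp add: algebra_simps)
      finally have "press X T f X d \<delta> / ereal (ln (1 / \<delta>))
          \<le> ereal ((c + \<eta> + \<eta>) * ln (2 / \<delta>) + B * ln 2) / ereal (ln (1 / \<delta>))"
        using ln_pos by (intro ereal_divide_right_mono) auto
      then show ?case
        using ln_pos by simp
    qed
    then have "upper_mdim X T f X d \<le> Limsup (at_right 0)
        (\<lambda>\<delta>. ereal (((c + \<eta> + \<eta>) * ln (2 / \<delta>) + B * ln 2) / ln (1 / \<delta>)))"
      unfolding upper_mdim_def by (rule Limsup_mono)
    also have "\<dots> = ereal (c + \<eta> + \<eta>)"
    proof (intro lim_imp_Limsup tendsto_ereal)
      \<comment> \<open>Halving the scale leaves the logarithm asymptotically unchanged, and the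
        constant \<open>B * ln 2\<close> is negligible against it.\<close>
      have lim: "((\<lambda>\<delta>::real. ln (2 / \<delta>) / ln (1 / \<delta>)) \<longlongrightarrow> 1) (at_right 0)"
        "((\<lambda>\<delta>::real. 1 / ln (1 / \<delta>)) \<longlongrightarrow> 0) (at_right 0)"
        by real_asymp+
      show "((\<lambda>\<delta>. ((c + \<eta> + \<eta>) * ln (2 / \<delta>) + B * ln 2) / ln (1 / \<delta>)) \<longlongrightarrow> c + \<eta> + \<eta>)
          (at_right 0)"
        using tendsto_add[OF tendsto_mult_left[OF lim(1), of "c + \<eta> + \<eta>"]
            tendsto_mult_left[OF lim(2), of "B * ln 2"]]
        by (simp add: add_divide_distrib)
    qed simp
    finally show ?thesis
      by (simp add: \<eta>_def add.commute)
  qed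
  then show "upper_mdim X T f X d \<le> ereal c"
    by (rule ereal_le_epsilon2)
qed

text \<open>Each set on the left lies in \<open>X\<close>, so its pressure sum is at most that of
  \<open>X\<close>; restricting to \<open>\<delta> < 1\<close> makes the divisor
  \<open>ln (1 / \<delta>)\<close> positive.\<close>

lemma upper_mdim_ge:
  "Limsup (at_right 0) (\<lambda>\<delta>.
      growth_rate (\<lambda>n. SUP x\<in>X.
        press_sum X T f ((T ^^ n) -` stable_set X d T \<epsilon> x \<inter> X) d \<delta> n) / ereal (ln (1 / \<delta>)))
    \<le> upper_mdim X T f X d"
  unfolding upper_mdim_def
proof (rule Limsup_mono)
  have "\<forall>\<^sub>F \<delta>::real in at_right 0. 0 < \<delta> \<and> \<delta> < 1"
    unfolding eventually_at_right_field by (intro exI[of _ 1]) auto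
  then show "\<forall>\<^sub>F \<delta> in at_right 0. growth_rate (\<lambda>n. SUP x\<in>X.
      press_sum X T f ((T ^^ n) -` stable_set X d T \<epsilon> x \<inter> X) d \<delta> n) / ereal (ln (1 / \<delta>))
    \<le> press X T f X d \<delta> / ereal (ln (1 / \<delta>))"
  proof eventually_elim
    case (elim \<delta>)
    have "ext_ln (SUP x\<in>X. press_sum X T f ((T ^^ n) -` stable_set X d T \<epsilon> x \<inter> X) d \<delta> n)
        / ereal (real n) \<le> ext_ln (press_sum X T f X d \<delta> n) / ereal (real n)" if "n \<ge> 1" for n
      using that by (intro ereal_divide_right_mono ext_ln_mono SUP_least press_sum_mono) auto
    then have "growth_rate (\<lambda>n. SUP x\<in>X.
        press_sum X T f ((T ^^ n) -` stable_set X d T \<epsilon> x \<inter> X) d \<delta> n) \<le> press X T f X d \<delta>"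
      unfolding growth_rate_def press_def by (intro Limsup_mono eventually_sequentiallyI[where c = 1])
    then show ?case
      using elim by (intro ereal_divide_right_mono) auto
  qed
qed

end

theorem theorem1p3:
  fixes X :: "'a set" and d :: "'a \<Rightarrow> 'a \<Rightarrow> real"
    and T :: "'a \<Rightarrow> 'a" and f :: "'a \<Rightarrow> real" and \<epsilon> :: real
  assumes "tds X d T"
    and "continuous_map (Metric_space.mtopology X d) euclideanreal f"
    and "\<epsilon> > 0"
  shows "upper_mdim X T f X d =
    Limsup (at_right 0) (\<lambda>\<delta>.
      growth_rate (\<lambda>n. SUP x\<in>X.
        press_sum X T f ((T ^^ n) -` stable_set X d T \<epsilon> x \<inter> X) d \<delta> n) / ereal (ln (1 / \<delta>)))"
proof -
  have M: "Metric_space X d"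
    using assms(1) by (simp add: tds_def)
  interpret compact_dynamics X d T
  proof (rule compact_dynamics.intro[OF M])
    show "compact_dynamics_axioms X d T"
      by (rule compact_dynamics_axioms.intro) (use assms(1) in \<open>simp_all add: tds_def\<close>)
  qed
  show ?thesis
    by (rule antisym[OF upper_mdim_le[OF assms(2,3)] upper_mdim_ge])
qed

end
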